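(* Let $G$ be both a groupoid and a topological space (no compatibility assumed) with Hausdorff unit space $G^0$ and a grading $\mathsf{c}:G\to\Gamma$, where $\Gamma$ is a groupoid, and let $Y$ be a unital $1$-cancellative semigroup. If $S\subseteq{}_Y\mathcal{B}^\circ_\mathsf{h}(G)$ is a bumpy semigroup with diagonal $D=\{d\in S:\mathrm{dom}(d)\subseteq G^0\}$, then $$g\mapsto S_g=\{a\in S:g\in\mathrm{int}([Y^\times]a)\}$$ is a homeomorphism from $G$ onto $\mathcal{U}(S)$. Moreover, for all $g,h\in G$ with $\mathsf{s}(g)=\mathsf{r}(h)$, $$S_{g^{-1}}=S_g^*,\qquad S_{gh}=(S_gS_h)^\prec\qquad\text{and}\qquad\mathsf{c}[S_g]=\{\mathsf{c}(g)\}.$$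
   Context: For a groupoid $G$: $\mathsf{s}(g)=g^{-1}g$, $\mathsf{r}(g)=gg^{-1}$; $G^0$ is the set of units; $gh$ is defined iff $\mathsf{s}(g)=\mathsf{r}(h)$; for $X,X'\subseteq G$, $XX'=\{xx':x\in X,x'\in X',\mathsf{s}(x)=\mathsf{r}(x')\}$ and $X^{-1}=\{x^{-1}:x\in X\}$. A bisection is $B\subseteq G$ with $BB^{-1}\cup B^{-1}B\subseteq G^0$. $\mathcal{O}(G)$ is the topology of $G$; $\mathrm{int}$ denotes interior in $G$. A grading $\mathsf{c}:G\to\Gamma$ is a map with $\mathsf{c}(xy)=\mathsf{c}(x)\mathsf{c}(y)$ (the right side being defined) whenever $xy$ is defined. $H\subseteq G$ is homogeneous if $\mathsf{c}$ is constant on $H$; $\mathcal{B}^\circ_\mathsf{h}(G)$ is the set of homogeneous open bisections. A unital semigroup $Y$ is $1$-cancellative if for all $x,y\in Y$: $xy=x\Leftrightarrow y=1\Leftrightarrow yx=x$. $Y^\times$ denotes its invertible elements. For a family $\mathcal{X}$ of subsets of $G$, ${}_Y\mathcal{X}$ is the set of partial functions $a$ from $G$ to $Y$ with domain $\mathrm{dom}(a)\in\mathcal{X}$. For $W\subseteq Y$, $[W]a=\{g\in\mathrm{dom}(a):a(g)\in W\}$, and $[1]a=[\{1\}]a$. If $\mathrm{dom}(a)$ or $\mathrm{dom}(b)$ is a bisection, $ab$ is the function with domain $\mathrm{dom}(a)\mathrm{dom}(b)$ given by $ab(gh)=a(g)b(h)$ for $g\in\mathrm{dom}(a)$, $h\in\mathrm{dom}(b)$,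 $\mathsf{s}(g)=\mathsf{r}(h)$; semigroups of functions carry this product. $S\subseteq{}_Y\mathcal{B}^\circ_\mathsf{h}(G)$ is bumpy if: (1-Proper) $[1]a$ is compact for all $a\in S$; (Urysohn) the empty function $\emptyset$ is in $S$, and whenever $g\in O\in\mathcal{O}(G)$ there is $a\in S$ with $\mathrm{dom}(a)\subseteq O$ and $g\in\mathrm{int}([Y^\times]a)$; (Involutive) whenever $a\in S$ and $g\in\mathrm{int}([Y^\times]a)$, there is $b\in S$ with $g^{-1}\in\mathrm{int}(\{h\in G:a(h^{-1})=b(h)^{-1}\})$. For $a\in S\setminus\{\emptyset\}$, $\mathsf{c}(a)\in\Gamma$ is the element with $\mathsf{c}[\mathrm{dom}(a)]=\{\mathsf{c}(a)\}$; for $T\subseteq S\setminus\{\emptyset\}$, $\mathsf{c}[T]=\{\mathsf{c}(a):a\in T\}$. Domination on $S$ (relative to $D$): $a\prec_s b$ iff $asb=a=bsa$ and $as,sa\in D$; $a\prec b$ iff $a\prec_s b$ for some $s\in S$. A filter is a nonempty $F\subseteq S$ such that for all $a,b\in S$: $a,b\in F$ iff there is $c\in F$ with $c\prec a$ and $c\prec b$. Ultrafilters are the maximal proper ($\neq S$) filters; $\mathcal{U}(S)$ is the set of ultrafilters, with the topology generated by the basis of sets $\mathcal{U}_a=\{U\in\mathcal{U}(S):a\in U\}$, $a\in S$. For $T,T'\subseteq S$: $TT'=\{tt':t\in T,t'\in T'\}$, $T^\prec=\{a\in S:\exists t\in T\ (t\prec a)\}$ and $T^*=\{s\in S:\exists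 t\in T\ \exists r\in S\ (t\prec_s r)\}$. *)

theory Defs
  imports "HOL-Analysis.Analysis" "HOL-Algebra.Group"
begin

section \<open>Groupoids\<close>

text \<open>
  The product is a total HOL function, but only its values on composable pairs matter:
  \<open>g h\<close> is defined when the source of \<open>g\<close> is the range of \<open>h\<close>.
\<close>

record 'g groupoid = "'g partial_object" +
  gmult :: "'g \<Rightarrow> 'g \<Rightarrow> 'g"
  ginv :: "'g \<Rightarrow> 'g"

definition gsource :: "'g groupoid \<Rightarrow> 'g \<Rightarrow> 'g" where
  "gsource G g = gmult G (ginv G g) g"

definition grange :: "'g groupoid \<Rightarrow> 'g \<Rightarrow> 'g" where
  "grange G g = gmult G g (ginv G g)"

text \<open>
  The usual algebraic axioms for a groupoid. Since \<open>(g\<inverse>)\<inverse> = g\<close>, the source of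
  \<open>g\<inverse>\<close> is the range of \<open>g\<close>, so \<open>g\<inverse> g\<close> and \<open>g g\<inverse>\<close> are products of composable pairs.
\<close>

locale groupoid =
  fixes G :: "'g groupoid"
  assumes ginv_closed: "g \<in> carrier G \<Longrightarrow> ginv G g \<in> carrier G"
    and ginv_ginv: "g \<in> carrier G \<Longrightarrow> ginv G (ginv G g) = g"
    and gmult_closed: "\<lbrakk>g \<in> carrier G; h \<in> carrier G; gsource G g = grange G h\<rbrakk>
          \<Longrightarrow> gmult G g h \<in> carrier G"
    and gsource_gmult: "\<lbrakk>g \<in> carrier G; h \<in> carrier G; gsource G g = grange G h\<rbrakk>
          \<Longrightarrow> gsource G (gmult G g h) = gsource G h"
    and grange_gmult: "\<lbrakk>g \<in> carrier G; h \<in> carrier G; gsource G g = grange G h\<rbrakk>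
          \<Longrightarrow> grange G (gmult G g h) = grange G g"
    and gmult_assoc: "\<lbrakk>g \<in> carrier G; h \<in> carrier G; k \<in> carrier G;
            gsource G g = grange G h; gsource G h = grange G k\<rbrakk>
          \<Longrightarrow> gmult G (gmult G g h) k = gmult G g (gmult G h k)"
    and ginv_cancel_left: "\<lbrakk>g \<in> carrier G; h \<in> carrier G; gsource G g = grange G h\<rbrakk>
          \<Longrightarrow> gmult G (ginv G g) (gmult G g h) = h"
    and ginv_cancel_right: "\<lbrakk>g \<in> carrier G; h \<in> carrier G; gsource G g = grange G h\<rbrakk>
          \<Longrightarrow> gmult G (gmult G g h) (ginv G h) = g"

definition gunits :: "'g groupoid \<Rightarrow> 'g set" where
  "gunits G = gsource G ` carrier G"

definition gset_mult :: "'g groupoid \<Rightarrow> 'g set \<Rightarrow> 'g set \<Rightarrow> 'g set" where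
  "gset_mult G A B = {gmult G x y | x y. x \<in> A \<and> y \<in> B \<and> gsource G x = grange G y}"

definition bisection :: "'g groupoid \<Rightarrow> 'g set \<Rightarrow> bool" where
  "bisection G B \<longleftrightarrow> B \<subseteq> carrier G \<and>
     gset_mult G B (ginv G ` B) \<union> gset_mult G (ginv G ` B) B \<subseteq> gunits G"

definition grading :: "'g groupoid \<Rightarrow> 'c groupoid \<Rightarrow> ('g \<Rightarrow> 'c) \<Rightarrow> bool" where
  "grading G \<Gamma> c \<longleftrightarrow> c \<in> carrier G \<rightarrow> carrier \<Gamma> \<and>
     (\<forall>x\<in>carrier G. \<forall>y\<in>carrier G. gsource G x = grange G y \<longrightarrow>
        gsource \<Gamma> (c x) = grange \<Gamma> (c y) \<and> c (gmult G x y) = gmult \<Gamma> (c x) (c y))"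

definition homogeneous :: "('g \<Rightarrow> 'c) \<Rightarrow> 'g set \<Rightarrow> bool" where
  "homogeneous c H \<longleftrightarrow> (\<forall>x\<in>H. \<forall>y\<in>H. c x = c y)"

definition hom_open_bisections ::
    "'g topology \<Rightarrow> 'g groupoid \<Rightarrow> ('g \<Rightarrow> 'c) \<Rightarrow> 'g set set" where
  "hom_open_bisections X G c = {B. openin X B \<and> bisection G B \<and> homogeneous c B}"


section \<open>Partial functions into a unital semigroup\<close>

definition one_cancellative :: "('y, 'm) monoid_scheme \<Rightarrow> bool" where
  "one_cancellative Y \<longleftrightarrow> (\<forall>x\<in>carrier Y. \<forall>y\<in>carrier Y.
     (x \<otimes>\<^bsub>Y\<^esub> y = x \<longleftrightarrow> y = \<one>\<^bsub>Y\<^esub>) \<and> (y = \<one>\<^bsub>Y\<^esub> \<longleftrightarrow> y \<otimes>\<^bsub>Y\<^esub> x = x))"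

definition pfuns :: "('y, 'm) monoid_scheme \<Rightarrow> 'g set set \<Rightarrow> ('g \<rightharpoonup> 'y) set" where
  "pfuns Y \<X> = {a. dom a \<in> \<X> \<and> ran a \<subseteq> carrier Y}"

definition preim :: "'y set \<Rightarrow> ('g \<rightharpoonup> 'y) \<Rightarrow> 'g set" where
  "preim W a = {g \<in> dom a. the (a g) \<in> W}"

text \<open>
  The description below determines the value uniquely when the domain of \<open>a\<close> or of \<open>b\<close> is a
  bisection, since then every element of the product of the domains factorises uniquely.
\<close>

definition pmult ::
    "'g groupoid \<Rightarrow> ('y, 'm) monoid_scheme \<Rightarrow> ('g \<rightharpoonup> 'y) \<Rightarrow> ('g \<rightharpoonup> 'y) \<Rightarrow> ('g \<rightharpoonup> 'y)" where
  "pmult G Y a b = (\<lambda>k.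
     if k \<in> gset_mult G (dom a) (dom b)
     then Some (THE y. \<exists>g\<in>dom a. \<exists>h\<in>dom b. gsource G g = grange G h \<and> k = gmult G g h \<and>
                   y = the (a g) \<otimes>\<^bsub>Y\<^esub> the (b h))
     else None)"

definition pset_mult ::
    "'g groupoid \<Rightarrow> ('y, 'm) monoid_scheme \<Rightarrow>
       ('g \<rightharpoonup> 'y) set \<Rightarrow> ('g \<rightharpoonup> 'y) set \<Rightarrow> ('g \<rightharpoonup> 'y) set" where
  "pset_mult G Y T T' = {pmult G Y t t' | t t'. t \<in> T \<and> t' \<in> T'}"

definition pfun_semigroup ::
    "'g groupoid \<Rightarrow> ('y, 'm) monoid_scheme \<Rightarrow> ('g \<rightharpoonup> 'y) set \<Rightarrow> bool" where
  "pfun_semigroup G Y S \<longleftrightarrow> (\<forall>a\<in>S. \<forall>b\<in>S. pmult G Y a b \<in> S)"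

definition bumpy ::
    "'g topology \<Rightarrow> 'g groupoid \<Rightarrow> ('y, 'm) monoid_scheme \<Rightarrow> ('g \<rightharpoonup> 'y) set \<Rightarrow> bool" where
  "bumpy X G Y S \<longleftrightarrow>
     \<comment> \<open>1-Proper\<close>
     (\<forall>a\<in>S. compactin X (preim {\<one>\<^bsub>Y\<^esub>} a)) \<and>
     \<comment> \<open>Urysohn\<close>
     Map.empty \<in> S \<and>
     (\<forall>V g. openin X V \<and> g \<in> V \<longrightarrow>
        (\<exists>a\<in>S. dom a \<subseteq> V \<and> g \<in> X interior_of (preim (Units Y) a))) \<and>
     \<comment> \<open>Involutive; \<open>a(h\<inverse>) = b(h)\<inverse>\<close> entails that both sides are defined\<close>
     (\<forall>a\<in>S. \<forall>g \<in> X interior_of (preim (Units Y) a).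
        \<exists>b\<in>S. ginv G g \<in> X interior_of
          {h \<in> carrier G. ginv G h \<in> dom a \<and> h \<in> dom b \<and> the (b h) \<in> Units Y \<and>
                          the (a (ginv G h)) = inv\<^bsub>Y\<^esub> (the (b h))})"

text \<open>Only meaningful for nonempty \<open>a\<close> with homogeneous domain.\<close>

definition pfun_grade :: "('g \<Rightarrow> 'c) \<Rightarrow> ('g \<rightharpoonup> 'y) \<Rightarrow> 'c" where
  "pfun_grade c a = (THE \<gamma>. c ` dom a = {\<gamma>})"

definition diagonal :: "'g groupoid \<Rightarrow> ('g \<rightharpoonup> 'y) set \<Rightarrow> ('g \<rightharpoonup> 'y) set" where
  "diagonal G S = {d \<in> S. dom d \<subseteq> gunits G}"


section \<open>Domination and ultrafilters\<close>

definition dominated_via ::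
    "'g groupoid \<Rightarrow> ('y, 'm) monoid_scheme \<Rightarrow> ('g \<rightharpoonup> 'y) set \<Rightarrow>
       ('g \<rightharpoonup> 'y) \<Rightarrow> ('g \<rightharpoonup> 'y) \<Rightarrow> ('g \<rightharpoonup> 'y) \<Rightarrow> bool" where
  "dominated_via G Y D s a b \<longleftrightarrow>
     pmult G Y (pmult G Y a s) b = a \<and> pmult G Y (pmult G Y b s) a = a \<and>
     pmult G Y a s \<in> D \<and> pmult G Y s a \<in> D"

definition dominated ::
    "'g groupoid \<Rightarrow> ('y, 'm) monoid_scheme \<Rightarrow> ('g \<rightharpoonup> 'y) set \<Rightarrow> ('g \<rightharpoonup> 'y) set \<Rightarrow>
       ('g \<rightharpoonup> 'y) \<Rightarrow> ('g \<rightharpoonup> 'y) \<Rightarrow> bool" where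
  "dominated G Y S D a b \<longleftrightarrow> (\<exists>s\<in>S. dominated_via G Y D s a b)"

definition dom_filter ::
    "'g groupoid \<Rightarrow> ('y, 'm) monoid_scheme \<Rightarrow> ('g \<rightharpoonup> 'y) set \<Rightarrow> ('g \<rightharpoonup> 'y) set \<Rightarrow>
       ('g \<rightharpoonup> 'y) set \<Rightarrow> bool" where
  "dom_filter G Y S D F \<longleftrightarrow> F \<noteq> {} \<and> F \<subseteq> S \<and>
     (\<forall>a\<in>S. \<forall>b\<in>S. a \<in> F \<and> b \<in> F \<longleftrightarrow>
        (\<exists>c\<in>F. dominated G Y S D c a \<and> dominated G Y S D c b))"

definition dom_ultrafilters ::
    "'g groupoid \<Rightarrow> ('y, 'm) monoid_scheme \<Rightarrow> ('g \<rightharpoonup> 'y) set \<Rightarrow> ('g \<rightharpoonup> 'y) set \<Rightarrow>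
       ('g \<rightharpoonup> 'y) set set" where
  "dom_ultrafilters G Y S D = {U. dom_filter G Y S D U \<and> U \<noteq> S \<and>
     (\<forall>F. dom_filter G Y S D F \<and> F \<noteq> S \<and> U \<subseteq> F \<longrightarrow> F = U)}"

definition ultrafilter_topology ::
    "'g groupoid \<Rightarrow> ('y, 'm) monoid_scheme \<Rightarrow> ('g \<rightharpoonup> 'y) set \<Rightarrow> ('g \<rightharpoonup> 'y) set \<Rightarrow>
       ('g \<rightharpoonup> 'y) set topology" where
  "ultrafilter_topology G Y S D =
     topology_generated_by {{U \<in> dom_ultrafilters G Y S D. a \<in> U} | a. a \<in> S}"

text \<open>Ultrafilters are nonempty subsets of \<open>S\<close>, so no point of the space is lost.\<close>

lemma topspace_ultrafilter_topology:
  "topspace (ultrafilter_topology G Y S D) = dom_ultrafilters G Y S D"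
proof -
  have "\<exists>a\<in>S. a \<in> U" if "U \<in> dom_ultrafilters G Y S D" for U
    using that by (force simp: dom_ultrafilters_def dom_filter_def)
  then show ?thesis
    unfolding ultrafilter_topology_def topology_generated_by_topspace by blast
qed

definition up_closure ::
    "'g groupoid \<Rightarrow> ('y, 'm) monoid_scheme \<Rightarrow> ('g \<rightharpoonup> 'y) set \<Rightarrow> ('g \<rightharpoonup> 'y) set \<Rightarrow>
       ('g \<rightharpoonup> 'y) set \<Rightarrow> ('g \<rightharpoonup> 'y) set" where
  "up_closure G Y S D T = {a \<in> S. \<exists>t\<in>T. dominated G Y S D t a}"

definition star_set ::
    "'g groupoid \<Rightarrow> ('y, 'm) monoid_scheme \<Rightarrow> ('g \<rightharpoonup> 'y) set \<Rightarrow> ('g \<rightharpoonup> 'y) set \<Rightarrow>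
       ('g \<rightharpoonup> 'y) set \<Rightarrow> ('g \<rightharpoonup> 'y) set" where
  "star_set G Y S D T = {s \<in> S. \<exists>t\<in>T. \<exists>r\<in>S. dominated_via G Y D s t r}"

definition point_filter ::
    "'g topology \<Rightarrow> ('y, 'm) monoid_scheme \<Rightarrow> ('g \<rightharpoonup> 'y) set \<Rightarrow> 'g \<Rightarrow> ('g \<rightharpoonup> 'y) set" where
  "point_filter X Y S g = {a \<in> S. g \<in> X interior_of (preim (Units Y) a)}"

end

theory Submission imports Defs begin

text \<open>
  The topology of \<open>G\<close> is not assumed to be related to its algebra, but a bumpy semigroup leaves
  no choice: since members of \<open>S\<close> have open domains and \<open>S\<close> is closed under products, the Urysohn
  axiom makes products of open sets open, and the Involutive axiom makes inversion continuous.
  It follows that the unit space is open and that the source map and the multiplication are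
  continuous.

  The second ingredient turns the algebraic relation of domination into a pointwise one. If
  \<open>a s b = a = b s a\<close> with \<open>a s\<close> and \<open>s a\<close> diagonal, then bisections force the three factors of
  a point \<open>g\<close> of \<open>dom a\<close> to be \<open>g\<close>, \<open>g\<inverse>\<close> and \<open>g\<close>, and 1-cancellativity turns the two
  equations into \<open>s(g\<inverse>) b(g) = 1 = b(g) s(g\<inverse>)\<close>. So \<open>a \<prec>\<^sub>s b\<close> just says that \<open>b\<close> is
  invertible, with inverse read off from \<open>s\<close>, on the whole of \<open>dom a\<close> (\<open>dominated_via_iff\<close>).
  The Involutive axiom supplies such an \<open>s\<close> near any point where \<open>b\<close> is locally invertible, and
  Urysohn supplies small functions \<open>a\<close>; hence \<open>S\<^sub>g\<close> is a filter, and the formulas for inverses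
  and products reduce to continuity of inversion and multiplication.

  The topology of \<open>G\<close> may fail to be Hausdorff, so compactness has to be used in the unit space.
  If \<open>a \<prec>\<^sub>s b\<close> then \<open>s b\<close> is \<open>1\<close> at the sources of \<open>dom a\<close>, and the source image of the compact set
  \<open>[1](s b)\<close> is a compact set, closed in the unit space, lying between the source images of \<open>dom a\<close>
  and \<open>dom b\<close> (\<open>dominated_compact_between\<close>). Filters are directed, so these compact sets have the finite
  intersection property within a proper filter and share a point \<open>x\<close>. As all small members
  of the filter live in one bisection, there is a single \<open>g\<close> above \<open>x\<close> in all their domains,
  so the filter lies in \<open>S\<^sub>g\<close> (\<open>ultrafilter_fixed\<close>). Compact sets of the same kind show
  that \<open>S\<^sub>g\<close> is maximal (\<open>point_filter_maximal\<close>). The ultrafilters are therefore exactly the sets \<open>S\<^sub>g\<close>,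
  and the Urysohn functions match the two topologies.
\<close>

section \<open>Elementary groupoid calculus\<close>

context groupoid
begin

lemma gsource_ginv: "g \<in> carrier G \<Longrightarrow> gsource G (ginv G g) = grange G g"
  and grange_ginv: "g \<in> carrier G \<Longrightarrow> grange G (ginv G g) = gsource G g"
  by (simp_all add: gsource_def grange_def ginv_ginv)

lemma gsource_closed: "g \<in> carrier G \<Longrightarrow> gsource G g \<in> carrier G"
  unfolding gsource_def[of G g] by (simp add: ginv_closed gmult_closed gsource_ginv)

lemma gsource_gsource: "g \<in> carrier G \<Longrightarrow> gsource G (gsource G g) = gsource G g"
  by (metis gsource_def gsource_ginv gsource_gmult ginv_closed)

lemma grange_gsource: "g \<in> carrier G \<Longrightarrow> grange G (gsource G g) = gsource G g"
  by (metis gsource_def gsource_ginv grange_ginv grange_gmult ginv_closed)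

lemma gmult_gsource: "g \<in> carrier G \<Longrightarrow> gmult G g (gsource G g) = g"
  by (metis ginv_cancel_left ginv_closed ginv_ginv gsource_def gsource_ginv)

lemma gmult_grange: "g \<in> carrier G \<Longrightarrow> gmult G (grange G g) g = g"
  by (metis ginv_cancel_right ginv_closed ginv_ginv grange_def grange_ginv)

lemma gsource_in_gunits: "g \<in> carrier G \<Longrightarrow> gsource G g \<in> gunits G"
  by (simp add: gunits_def)

lemma grange_in_gunits: "g \<in> carrier G \<Longrightarrow> grange G g \<in> gunits G"
  using gsource_in_gunits[OF ginv_closed] by (simp add: gsource_ginv)

lemma gunitsD:
  assumes "u \<in> gunits G"
  shows "u \<in> carrier G" "gsource G u = u" "grange G u = u"
  using assms by (auto simp: gunits_def gsource_closed gsource_gsource grange_gsource)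

lemma gset_multI:
  "\<lbrakk>x \<in> A; y \<in> B; gsource G x = grange G y\<rbrakk> \<Longrightarrow> gmult G x y \<in> gset_mult G A B"
  by (auto simp: gset_mult_def)

lemma gset_multE:
  assumes "k \<in> gset_mult G A B"
  obtains x y where "x \<in> A" "y \<in> B" "gsource G x = grange G y" "k = gmult G x y"
  using assms by (auto simp: gset_mult_def)

lemma gmult_unit_imp_ginv:
  assumes g: "g \<in> carrier G" and h: "h \<in> carrier G" and gh: "gsource G g = grange G h"
    and u: "gmult G g h \<in> gunits G"
  shows "h = ginv G g"
proof -
  have "gmult G g h = grange G g"
    using gunitsD(3)[OF u] grange_gmult[OF g h gh] by simp
  then have "h = gmult G (ginv G g) (grange G g)"
    using ginv_cancel_left[OF g h gh] by simp
  then show ?thesis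
    using gmult_gsource[OF ginv_closed[OF g]] gsource_ginv[OF g] by simp
qed

lemma bisection_source_eqD:
  assumes B: "bisection G B" and "g \<in> B" "h \<in> B" and eq: "gsource G g = gsource G h"
  shows "g = h"
proof -
  have [simp]: "g \<in> carrier G" "h \<in> carrier G"
    using assms by (auto simp: bisection_def)
  have "gmult G g (ginv G h) \<in> gunits G"
    using gset_multI[of g B "ginv G h" "ginv G ` B"] assms by (auto simp: bisection_def grange_ginv)
  then have "ginv G h = ginv G g"
    by (intro gmult_unit_imp_ginv) (simp_all add: ginv_closed grange_ginv eq)
  then show ?thesis
    by (metis \<open>g \<in> carrier G\<close> \<open>h \<in> carrier G\<close> ginv_ginv)
qed

lemma bisection_range_eqD:
  assumes B: "bisection G B" and "g \<in> B" "h \<in> B" and eq: "grange G g = grange G h"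
  shows "g = h"
proof -
  have [simp]: "g \<in> carrier G" "h \<in> carrier G"
    using assms by (auto simp: bisection_def)
  have "gmult G (ginv G g) h \<in> gunits G"
    using gset_multI[of "ginv G g" "ginv G ` B" h B] assms by (auto simp: bisection_def gsource_ginv)
  then have "h = ginv G (ginv G g)"
    by (intro gmult_unit_imp_ginv) (simp_all add: ginv_closed gsource_ginv eq)
  then show ?thesis
    by (simp add: ginv_ginv)
qed

text \<open>
  On a bisection every element of the product of the domains factorises uniquely, so the
  definite description defining the product of functions takes the expected value.
\<close>

lemma pmult_apply:
  assumes A: "bisection G (dom a)" and b: "dom b \<subseteq> carrier G"
    and gh: "g \<in> dom a" "h \<in> dom b" "gsource G g = grange G h"
  shows "pmult G Y a b (gmult G g h) = Some (the (a g) \<otimes>\<^bsub>Y\<^esub> the (b h))"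
proof -
  have carr: "x \<in> carrier G" if "x \<in> dom a \<or> x \<in> dom b" for x
    using that A b by (auto simp: bisection_def)
  \<comment> \<open>The left factor is determined by its range, and then cancels.\<close>
  have unique: "x = g \<and> y = h"
    if xy: "x \<in> dom a" "y \<in> dom b" "gsource G x = grange G y" "gmult G g h = gmult G x y" for x y
  proof -
    have "grange G x = grange G g"
      using grange_gmult[of g h] grange_gmult[of x y] carr gh xy by simp
    then have "x = g"
      using bisection_range_eqD[OF A] xy gh by blast
    moreover have "y = h"
      using ginv_cancel_left[of g h] ginv_cancel_left[of x y] carr gh xy \<open>x = g\<close> by simp
    ultimately show ?thesis by simp
  qed
  have "(THE y. \<exists>x\<in>dom a. \<exists>z\<in>dom b. gsource G x = grange G z \<and> gmult G g h = gmult G x z \<and>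
          y = the (a x) \<otimes>\<^bsub>Y\<^esub> the (b z)) = the (a g) \<otimes>\<^bsub>Y\<^esub> the (b h)"
    using gh unique by (intro the_equality) blast+
  then show ?thesis
    using gset_multI[OF gh] by (simp add: pmult_def)
qed

end

lemma dom_pmult: "dom (pmult G Y a b) = gset_mult G (dom a) (dom b)"
  by (auto simp: pmult_def split: if_splits)


section \<open>Bumpy semigroups\<close>

locale bumpy_semigroup = groupoid G + monoid Y
  for G :: "'g groupoid" and Y :: "('y, 'm) monoid_scheme" (structure) +
  fixes X :: "'g topology" and c :: "'g \<Rightarrow> 'c" and S :: "('g \<rightharpoonup> 'y) set"
  assumes topspace_eq: "topspace X = carrier G"
    and Hausdorff_units: "Hausdorff_space (subtopology X (gunits G))"
    and cancellative: "one_cancellative Y"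
    and S_sub: "S \<subseteq> pfuns Y (hom_open_bisections X G c)"
    and semigroup: "pfun_semigroup G Y S"
    and bumpy: "bumpy X G Y S"
begin

abbreviation "D \<equiv> diagonal G S"

abbreviation "pfilter g \<equiv> point_filter X Y S g"

text \<open>
  This is the set occurring in the Involutive axiom. It is where \<open>s\<close> inverts \<open>b\<close>,
  and it also characterises domination.
\<close>

definition inverse_locus :: "('g \<rightharpoonup> 'y) \<Rightarrow> ('g \<rightharpoonup> 'y) \<Rightarrow> 'g set" where
  "inverse_locus s b = {h \<in> carrier G. ginv G h \<in> dom s \<and> h \<in> dom b \<and> the (b h) \<in> Units Y \<and>
     the (s (ginv G h)) = inv (the (b h))}"

lemma S_bisection: "a \<in> S \<Longrightarrow> bisection G (dom a)"
  and S_openin: "a \<in> S \<Longrightarrow> openin X (dom a)"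
  and S_homogeneous: "a \<in> S \<Longrightarrow> homogeneous c (dom a)"
  using S_sub by (auto simp: pfuns_def hom_open_bisections_def)

lemma S_carrier: "a \<in> S \<Longrightarrow> g \<in> dom a \<Longrightarrow> g \<in> carrier G"
  using S_bisection unfolding bisection_def by blast

lemma S_dom_subset: "a \<in> S \<Longrightarrow> dom a \<subseteq> carrier G"
  using S_carrier by blast

lemma S_value_closed: "a \<in> S \<Longrightarrow> g \<in> dom a \<Longrightarrow> the (a g) \<in> carrier Y"
  using S_sub by (force simp: pfuns_def ran_def)

lemma S_pmult: "a \<in> S \<Longrightarrow> b \<in> S \<Longrightarrow> pmult G Y a b \<in> S"
  using semigroup by (simp add: pfun_semigroup_def)

lemma S_pmult_apply:
  "\<lbrakk>a \<in> S; b \<in> S; g \<in> dom a; h \<in> dom b; gsource G g = grange G h\<rbrakk>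
    \<Longrightarrow> pmult G Y a b (gmult G g h) = Some (the (a g) \<otimes> the (b h))"
  using S_bisection S_dom_subset by (intro pmult_apply) auto

lemma empty_in_S: "Map.empty \<in> S"
  using bumpy by (simp add: bumpy_def)

lemma compactin_preim_one: "a \<in> S \<Longrightarrow> compactin X (preim {\<one>} a)"
  using bumpy by (simp add: bumpy_def)

lemma point_filterD:
  assumes "a \<in> pfilter g"
  shows "a \<in> S" "g \<in> dom a" "g \<in> X interior_of preim (Units Y) a" "g \<in> carrier G"
proof -
  show "a \<in> S" and g: "g \<in> X interior_of preim (Units Y) a"
    using assms by (auto simp: point_filter_def)
  show "g \<in> dom a"
    using g interior_of_subset[of X "preim (Units Y) a"] by (auto simp: preim_def)
  then show "g \<in> carrier G"
    using \<open>a \<in> S\<close> S_carrier by blast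
qed

lemma Urysohn:
  assumes "openin X V" "g \<in> V"
  obtains a where "a \<in> pfilter g" "dom a \<subseteq> V"
proof -
  have "\<forall>V g. openin X V \<and> g \<in> V \<longrightarrow>
      (\<exists>a\<in>S. dom a \<subseteq> V \<and> g \<in> X interior_of (preim (Units Y) a))"
    using bumpy unfolding bumpy_def by (elim conjE)
  with assms obtain a where "a \<in> S" "dom a \<subseteq> V" "g \<in> X interior_of (preim (Units Y) a)"
    by blast
  then show thesis
    by (intro that[of a]) (simp_all add: point_filter_def)
qed

lemma Involutive:
  assumes "a \<in> pfilter g"
  obtains b where "b \<in> S" "ginv G g \<in> X interior_of inverse_locus a b"
proof -
  have "\<forall>a\<in>S. \<forall>g \<in> X interior_of (preim (Units Y) a).
      \<exists>b\<in>S. ginv G g \<in> X interior_of inverse_locus a b"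
    using bumpy unfolding bumpy_def inverse_locus_def by (elim conjE)
  then show thesis
    using assms that by (auto simp: point_filter_def)
qed

section \<open>Openness of inverses and products\<close>

text \<open>
  A Urysohn function \<open>a\<close> at \<open>g\<inverse>\<close> inside \<open>V\<close> has an involutive partner \<open>b\<close> that inverts it on a
  neighbourhood of \<open>g\<close>. Every inverse of a point of that neighbourhood lies in \<open>dom a\<close>, hence in \<open>V\<close>.
\<close>

lemma openin_ginv_preimage:
  assumes V: "openin X V"
  shows "openin X {g \<in> carrier G. ginv G g \<in> V}"
proof (subst openin_subopen, intro ballI)
  fix g assume "g \<in> {g \<in> carrier G. ginv G g \<in> V}"
  then have g: "g \<in> carrier G" "ginv G g \<in> V" by auto
  obtain a where a: "a \<in> pfilter (ginv G g)" "dom a \<subseteq> V"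
    using Urysohn[OF V g(2)] .
  obtain b where b: "b \<in> S" "g \<in> X interior_of inverse_locus a b"
    using Involutive[OF a(1)] g by (auto simp: ginv_ginv)
  have "X interior_of inverse_locus a b \<subseteq> {g \<in> carrier G. ginv G g \<in> V}"
    using interior_of_subset[of X "inverse_locus a b"] a(2) by (auto simp: inverse_locus_def)
  then show "\<exists>T. openin X T \<and> g \<in> T \<and> T \<subseteq> {g \<in> carrier G. ginv G g \<in> V}"
    using b(2) by (intro exI[of _ "X interior_of inverse_locus a b"]) simp
qed

lemma ginv_image_eq:
  assumes "V \<subseteq> carrier G"
  shows "ginv G ` V = {g \<in> carrier G. ginv G g \<in> V}"
proof (intro equalityI subsetI)
  fix g assume "g \<in> {g \<in> carrier G. ginv G g \<in> V}"
  then show "g \<in> ginv G ` V"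
    by (intro image_eqI[of _ _ "ginv G g"]) (simp_all add: ginv_ginv)
next
  fix g assume "g \<in> ginv G ` V"
  then show "g \<in> {g \<in> carrier G. ginv G g \<in> V}"
    using assms by (auto simp: ginv_closed ginv_ginv subset_iff)
qed

lemma openin_ginv_image:
  assumes V: "openin X V"
  shows "openin X (ginv G ` V)"
proof -
  have "V \<subseteq> carrier G"
    using openin_subset[OF V] topspace_eq by simp
  then show ?thesis
    using openin_ginv_preimage[OF V] by (simp add: ginv_image_eq)
qed

text \<open>
  A product of domains is the domain of a product, and the latter is open as \<open>S\<close> is a semigroup.
\<close>

lemma openin_gset_mult:
  assumes U: "openin X U" and V: "openin X V"
  shows "openin X (gset_mult G U V)"
proof (subst openin_subopen, intro ballI)
  fix k assume "k \<in> gset_mult G U V"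
  then obtain g h where gh: "g \<in> U" "h \<in> V" "gsource G g = grange G h" and k: "k = gmult G g h"
    by (rule gset_multE)
  obtain a where a: "a \<in> pfilter g" "dom a \<subseteq> U"
    using Urysohn[OF U gh(1)] .
  obtain b where b: "b \<in> pfilter h" "dom b \<subseteq> V"
    using Urysohn[OF V gh(2)] .
  have "openin X (gset_mult G (dom a) (dom b))"
    using S_openin[OF S_pmult] point_filterD(1)[OF a(1)] point_filterD(1)[OF b(1)]
    by (metis dom_pmult)
  moreover have "k \<in> gset_mult G (dom a) (dom b)"
    using point_filterD(2)[OF a(1)] point_filterD(2)[OF b(1)] gh(3) k by (simp add: gset_multI)
  moreover have "gset_mult G (dom a) (dom b) \<subseteq> gset_mult G U V"
    using a(2) b(2) by (fastforce simp: gset_mult_def)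
  ultimately show "\<exists>T. openin X T \<and> k \<in> T \<and> T \<subseteq> gset_mult G U V"
    by blast
qed

text \<open>
  The Involutive axiom only controls a neighbourhood of \<open>g\<inverse>\<close>, continuity of inversion moves it to \<open>g\<close>.
\<close>

lemma inverse_locus_exists:
  assumes b: "b \<in> pfilter g"
  obtains s V where "s \<in> S" "openin X V" "g \<in> V" "V \<subseteq> inverse_locus s b"
proof -
  obtain s where s: "s \<in> S" "ginv G g \<in> X interior_of inverse_locus b s"
    using Involutive[OF b] .
  let ?W = "X interior_of inverse_locus b s"
  let ?V = "{h \<in> carrier G. ginv G h \<in> ?W}"
  have "h \<in> inverse_locus s b" if "h \<in> ?V" for h
    using that interior_of_subset[of X "inverse_locus b s"]
    by (auto simp: inverse_locus_def ginv_ginv)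
  then have sub: "?V \<subseteq> inverse_locus s b"
    by (rule subsetI)
  have "g \<in> ?V"
    using s(2) point_filterD(4)[OF b] by simp
  then show thesis
    by (rule that[OF s(1) openin_ginv_preimage[OF openin_interior_of] _ sub])
qed

section \<open>Domination as pointwise invertibility\<close>

text \<open>
  In a factorisation \<open>g = g' k h\<close> along \<open>a s b = a\<close>, diagonality of \<open>a s\<close> makes \<open>g' k\<close> a unit, so \<open>h = g\<close>;
  comparing ranges in the bisection \<open>dom a\<close> gives \<open>g' = g\<close>, and so \<open>k = g\<inverse>\<close>. Thus
  \<open>a(g) s(g\<inverse>) b(g) = a(g)\<close>, where \<open>a(g)\<close> can be dropped by 1-cancellativity. Conversely, once
  \<open>dom s\<close> contains the inverses of \<open>dom a\<close>, the bisection property excludes all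
  other composable pairs, so that \<open>a s b\<close> and \<open>b s a\<close> have no further points in their domains.
\<close>

lemma dominated_via_iff:
  assumes a: "a \<in> S" and s: "s \<in> S" and b: "b \<in> S"
  shows "dominated_via G Y D s a b \<longleftrightarrow> dom a \<subseteq> inverse_locus s b"
proof
  assume dom: "dominated_via G Y D s a b"
  have as: "pmult G Y a s \<in> S" and bs: "pmult G Y b s \<in> S"
    using S_pmult a s b by auto
  \<comment> \<open>The equation \<open>a s b = a\<close> and diagonality give the domain conditions and a one-sided inverse.\<close>
  have left: "g \<in> dom b \<and> ginv G g \<in> dom s \<and> the (s (ginv G g)) \<otimes> the (b g) = \<one>"
    if g: "g \<in> dom a" for g
  proof -
    have eq: "pmult G Y (pmult G Y a s) b = a"
      and unit: "dom (pmult G Y a s) \<subseteq> gunits G"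
      using dom by (auto simp: dominated_via_def diagonal_def)
    obtain u h where u: "u \<in> gset_mult G (dom a) (dom s)"
      and h: "h \<in> dom b" "gsource G u = grange G h" "g = gmult G u h"
    proof -
      have "g \<in> gset_mult G (gset_mult G (dom a) (dom s)) (dom b)"
        using g eq dom_pmult by metis
      then show thesis
        using that by (auto elim: gset_multE)
    qed
    obtain g' k where g': "g' \<in> dom a" "k \<in> dom s" "gsource G g' = grange G k" "u = gmult G g' k"
      using u by (rule gset_multE)
    note carr = S_carrier[OF a g'(1)] S_carrier[OF s g'(2)] S_carrier[OF b h(1)] S_carrier[OF a g]
    have uu: "u \<in> gunits G"
      using unit u by (auto simp: dom_pmult)
    have k: "k = ginv G g'"
      using gmult_unit_imp_ginv carr g' uu by blast
    have "u = grange G h"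
      using gunitsD(2)[OF uu] h(2) by simp
    then have gh: "g = h"
      using h(3) carr by (simp add: gmult_grange)
    have "grange G g' = grange G g"
      using g'(3,4) grange_gmult[of g' k] carr gunitsD(3)[OF uu] \<open>u = grange G h\<close> gh by simp
    then have gg': "g' = g"
      using bisection_range_eqD[OF S_bisection[OF a]] g g'(1) by blast
    have kg: "ginv G g \<in> dom s"
      using k g'(2) gg' by simp
    have "u \<in> dom (pmult G Y a s)"
      using u by (simp add: dom_pmult)
    then have "a g = Some (the (pmult G Y a s u) \<otimes> the (b g))"
      using S_pmult_apply[OF as b, of u h] h eq gh by simp
    moreover have "pmult G Y a s u = Some (the (a g) \<otimes> the (s (ginv G g)))"
      using S_pmult_apply[OF a s, of g' k] g' gg' k by simp
    ultimately have "the (a g) = the (a g) \<otimes> the (s (ginv G g)) \<otimes> the (b g)"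
      by (metis option.sel)
    then have "the (a g) \<otimes> (the (s (ginv G g)) \<otimes> the (b g)) = the (a g)"
      using S_value_closed a s b g kg h(1) gh by (simp add: m_assoc)
    then have "the (s (ginv G g)) \<otimes> the (b g) = \<one>"
      using cancellative S_value_closed[OF a g] S_value_closed[OF s kg] S_value_closed[OF b h(1)] gh
      unfolding one_cancellative_def by (metis m_closed)
    then show ?thesis
      using h(1) gh kg by simp
  qed
  \<comment> \<open>The equation \<open>b s a = a\<close> gives the inverse on the other side.\<close>
  have right: "the (b g) \<otimes> the (s (ginv G g)) = \<one>"
    if g: "g \<in> dom a" for g
  proof -
    have eq: "pmult G Y (pmult G Y b s) a = a"
      using dom by (auto simp: dominated_via_def)
    note gb = conjunct1[OF left[OF g]] and gs = conjunct1[OF conjunct2[OF left[OF g]]]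
    note carr = S_carrier[OF a g]
    have u: "pmult G Y b s (grange G g) = Some (the (b g) \<otimes> the (s (ginv G g)))"
      using S_pmult_apply[OF b s gb gs grange_ginv[OF carr, symmetric]] by (simp add: grange_def)
    then have "pmult G Y (pmult G Y b s) a (gmult G (grange G g) g)
        = Some (the (b g) \<otimes> the (s (ginv G g)) \<otimes> the (a g))"
      using S_pmult_apply[OF bs a, of "grange G g" g] g
        gunitsD(2)[OF grange_in_gunits[OF carr]] by (auto simp: dom_def)
    then have "the (b g) \<otimes> the (s (ginv G g)) \<otimes> the (a g) = the (a g)"
      unfolding eq gmult_grange[OF carr] by (metis option.sel)
    then show ?thesis
      using cancellative S_value_closed[OF a g] S_value_closed[OF s gs] S_value_closed[OF b gb]
      unfolding one_cancellative_def by (metis m_closed)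
  qed
  show "dom a \<subseteq> inverse_locus s b"
  proof
    fix g assume g: "g \<in> dom a"
    note l = left[OF g] and r = right[OF g]
    have cl: "the (b g) \<in> carrier Y" "the (s (ginv G g)) \<in> carrier Y"
      using S_value_closed b s l by auto
    then have "the (b g) \<in> Units Y"
      using l r by (auto simp: Units_def)
    moreover have "the (s (ginv G g)) = inv (the (b g))"
      using inv_unique'[OF cl] l r by simp
    ultimately show "g \<in> inverse_locus s b"
      using l S_carrier[OF a g] by (simp add: inverse_locus_def)
  qed
next
  assume sub: "dom a \<subseteq> inverse_locus s b"
  have sb: "g \<in> dom b" "ginv G g \<in> dom s" "g \<in> carrier G"
    "the (b g) \<in> Units Y" "the (s (ginv G g)) = inv (the (b g))" if "g \<in> dom a" for g
    using sub that by (auto simp: inverse_locus_def)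
  have as: "pmult G Y a s \<in> S" and bs: "pmult G Y b s \<in> S" and sa: "pmult G Y s a \<in> S"
    using S_pmult a s b by auto
  have as_fact: "k = ginv G g"
    if "g \<in> dom a" "k \<in> dom s" "gsource G g = grange G k" for g k
    using bisection_range_eqD[OF S_bisection[OF s], of k "ginv G g"] that sb by (simp add: grange_ginv)
  have sa_fact: "k = ginv G g"
    if "g \<in> dom a" "k \<in> dom s" "gsource G k = grange G g" for g k
    using bisection_source_eqD[OF S_bisection[OF s], of k "ginv G g"] that sb by (simp add: gsource_ginv)
  \<comment> \<open>The only composable pairs in \<open>dom a\<close> and \<open>dom s\<close> are \<open>g\<close> with \<open>g\<inverse>\<close>, in either order.\<close>
  have "gmult G g k \<in> gunits G"
    if "g \<in> dom a" "k \<in> dom s" "gsource G g = grange G k" for g k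
    using as_fact[OF that] grange_in_gunits[OF sb(3)[OF that(1)]] by (simp add: grange_def)
  then have "gset_mult G (dom a) (dom s) \<subseteq> gunits G"
    by (blast elim: gset_multE)
  then have D1: "pmult G Y a s \<in> D"
    using as by (simp add: diagonal_def dom_pmult)
  have "gmult G k g \<in> gunits G"
    if "g \<in> dom a" "k \<in> dom s" "gsource G k = grange G g" for g k
    using sa_fact[OF that] gsource_in_gunits[OF sb(3)[OF that(1)]] by (simp add: gsource_def)
  then have "gset_mult G (dom s) (dom a) \<subseteq> gunits G"
    by (blast elim: gset_multE)
  then have D2: "pmult G Y s a \<in> D"
    using sa by (simp add: diagonal_def dom_pmult)
  have asb_value: "pmult G Y (pmult G Y a s) b g = a g" if g: "g \<in> dom a" for g
  proof -
    have u: "pmult G Y a s (grange G g) = Some (the (a g) \<otimes> the (s (ginv G g)))"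
      using S_pmult_apply[OF a s g sb(2)[OF g] grange_ginv[OF sb(3)[OF g], symmetric]]
      by (simp add: grange_def)
    then have "pmult G Y (pmult G Y a s) b (gmult G (grange G g) g)
        = Some (the (a g) \<otimes> the (s (ginv G g)) \<otimes> the (b g))"
      using S_pmult_apply[OF as b, of "grange G g" g] sb(1)[OF g]
        gunitsD(2)[OF grange_in_gunits[OF sb(3)[OF g]]] by (auto simp: dom_def)
    also have "\<dots> = a g"
      using g sb(4,5)[OF g] S_value_closed[OF a g] by (auto simp: m_assoc Units_closed)
    finally show ?thesis
      using sb(3)[OF g] by (simp add: gmult_grange)
  qed
  have bsa_value: "pmult G Y (pmult G Y b s) a g = a g" if g: "g \<in> dom a" for g
  proof -
    have u: "pmult G Y b s (grange G g) = Some (the (b g) \<otimes> the (s (ginv G g)))"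
      using S_pmult_apply[OF b s sb(1,2)[OF g] grange_ginv[OF sb(3)[OF g], symmetric]]
      by (simp add: grange_def)
    then have "pmult G Y (pmult G Y b s) a (gmult G (grange G g) g)
        = Some (the (b g) \<otimes> the (s (ginv G g)) \<otimes> the (a g))"
      using S_pmult_apply[OF bs a, of "grange G g" g] g
        gunitsD(2)[OF grange_in_gunits[OF sb(3)[OF g]]] by (auto simp: dom_def)
    also have "\<dots> = a g"
      using g sb(4,5)[OF g] S_value_closed[OF a g] by auto
    finally show ?thesis
      using sb(3)[OF g] by (simp add: gmult_grange)
  qed
  have "dom (pmult G Y (pmult G Y a s) b) \<subseteq> dom a"
  proof
    fix x assume "x \<in> dom (pmult G Y (pmult G Y a s) b)"
    then obtain g k h where g: "g \<in> dom a" "k \<in> dom s" "gsource G g = grange G k"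
      and h: "h \<in> dom b" "gsource G (gmult G g k) = grange G h" and x: "x = gmult G (gmult G g k) h"
      by (auto simp: dom_pmult elim!: gset_multE)
    have u: "gmult G g k = grange G g"
      using as_fact[OF g] by (simp add: grange_def)
    then have "grange G h = grange G g"
      using h(2) gunitsD(2)[OF grange_in_gunits[OF sb(3)[OF g(1)]]] by simp
    then have "h = g"
      using bisection_range_eqD[OF S_bisection[OF b] h(1) sb(1)[OF g(1)]] by simp
    then show "x \<in> dom a"
      using x u g(1) sb(3) by (simp add: gmult_grange)
  qed
  moreover have "dom (pmult G Y (pmult G Y b s) a) \<subseteq> dom a"
  proof
    fix x assume "x \<in> dom (pmult G Y (pmult G Y b s) a)"
    then obtain h k g where g: "g \<in> dom a" "k \<in> dom s" "gsource G h = grange G k"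
      and h: "h \<in> dom b" "gsource G (gmult G h k) = grange G g" and x: "x = gmult G (gmult G h k) g"
      by (auto simp: dom_pmult elim!: gset_multE)
    note carr = S_carrier[OF b h(1)] S_carrier[OF s g(2)]
    have "k = ginv G g"
      using sa_fact[OF g(1,2)] h(2) gsource_gmult[OF carr g(3)] by simp
    then have "h = g"
      using g(3) bisection_source_eqD[OF S_bisection[OF b] h(1) sb(1)[OF g(1)]] sb(3)[OF g(1)]
      by (simp add: grange_ginv)
    then show "x \<in> dom a"
      using x \<open>k = ginv G g\<close> g(1) sb(3) by (simp add: grange_def[symmetric] gmult_grange)
  qed
  ultimately have "pmult G Y (pmult G Y a s) b = a" "pmult G Y (pmult G Y b s) a = a"
    using asb_value bsa_value
    by (metis domIff ext in_mono)+
  then show "dominated_via G Y D s a b"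
    using D1 D2 by (simp add: dominated_via_def)
qed

lemma dominated_iff:
  assumes "a \<in> S" "b \<in> S"
  shows "dominated G Y S D a b \<longleftrightarrow> (\<exists>s\<in>S. dom a \<subseteq> inverse_locus s b)"
  using assms dominated_via_iff by (auto simp: dominated_def)

lemma dominated_dom_subset:
  assumes "a \<in> S" "b \<in> S" "dominated G Y S D a b"
  shows "dom a \<subseteq> dom b"
  using assms by (auto simp: dominated_iff inverse_locus_def)

text \<open>
  Invertibility of the larger function on the open domain of the smaller one is
  what places it in \<open>S\<^sub>g\<close>, for each \<open>g\<close> in that domain.
\<close>

lemma dominated_point_filter:
  assumes a: "a \<in> S" and b: "b \<in> S" and ab: "dominated G Y S D a b" and g: "g \<in> dom a"
  shows "b \<in> pfilter g"
proof -
  have "dom a \<subseteq> preim (Units Y) b"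
    using ab a b by (auto simp: dominated_iff inverse_locus_def preim_def)
  then have "dom a \<subseteq> X interior_of preim (Units Y) b"
    using S_openin[OF a] by (simp add: interior_of_maximal)
  then show ?thesis
    using g b by (auto simp: point_filter_def)
qed

lemma empty_dominated: "b \<in> S \<Longrightarrow> dominated G Y S D Map.empty b"
  using empty_in_S by (auto simp: dominated_iff)

section \<open>The unit space, sources and multiplication\<close>

text \<open>
  If \<open>a \<prec>\<^sub>s b\<close> with \<open>u \<in> dom a\<close>, then \<open>dom (a s)\<close> is an open set of units around \<open>u\<close>.
\<close>

lemma openin_gunits: "openin X (gunits G)"
proof (subst openin_subopen, intro ballI)
  fix u assume u: "u \<in> gunits G"
  then have "u \<in> topspace X" using gunitsD(1) topspace_eq by simp
  then obtain b where b: "b \<in> pfilter u"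
    using Urysohn[OF openin_topspace] by blast
  obtain s V where s: "s \<in> S" "openin X V" "u \<in> V" "V \<subseteq> inverse_locus s b"
    using inverse_locus_exists[OF b] .
  obtain a where a: "a \<in> pfilter u" "dom a \<subseteq> V"
    using Urysohn[OF s(2,3)] .
  note aS = point_filterD(1)[OF a(1)] and ua = point_filterD(2)[OF a(1)]
  have "dominated_via G Y D s a b"
    using dominated_via_iff[OF aS s(1) point_filterD(1)[OF b]] a(2) s(4) by blast
  then have as: "pmult G Y a s \<in> D"
    by (simp add: dominated_via_def)
  have "ginv G u \<in> dom s"
    using ua a(2) s(4) by (auto simp: inverse_locus_def)
  then have "gmult G u (ginv G u) \<in> dom (pmult G Y a s)"
    using gset_multI[OF ua] gunitsD(1)[OF u] by (simp add: dom_pmult grange_ginv)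
  then have "grange G u \<in> dom (pmult G Y a s)"
    unfolding grange_def .
  then show "\<exists>T. openin X T \<and> u \<in> T \<and> T \<subseteq> gunits G"
    unfolding gunitsD(3)[OF u] using as S_openin unfolding diagonal_def by blast
qed

text \<open>
  Writing preimages under the source map as products reduces continuity of the source map to
  openness of the multiplication and of the unit space.
\<close>

lemma gsource_preimage:
  "{g \<in> carrier G. gsource G g \<in> V} = gset_mult G (carrier G) (V \<inter> gunits G)"
proof (intro equalityI subsetI)
  fix g assume "g \<in> {g \<in> carrier G. gsource G g \<in> V}"
  then have g: "g \<in> carrier G" "gsource G g \<in> V"
    by simp_all
  have "gsource G g \<in> V \<inter> gunits G"
    using g gsource_in_gunits by blast
  then have "gmult G g (gsource G g) \<in> gset_mult G (carrier G) (V \<inter> gunits G)"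
    by (rule gset_multI[OF g(1) _ grange_gsource[OF g(1), symmetric]])
  then show "g \<in> gset_mult G (carrier G) (V \<inter> gunits G)"
    unfolding gmult_gsource[OF g(1)] .
next
  fix g assume "g \<in> gset_mult G (carrier G) (V \<inter> gunits G)"
  then obtain x u where x: "x \<in> carrier G" "u \<in> V \<inter> gunits G"
    "gsource G x = grange G u" "g = gmult G x u"
    by (rule gset_multE)
  then have "gsource G x = u" using gunitsD(3) by auto
  then have "g = x" using x gmult_gsource by auto
  then show "g \<in> {g \<in> carrier G. gsource G g \<in> V}"
    using x \<open>gsource G x = u\<close> by blast
qed

lemma continuous_map_gsource: "continuous_map X X (gsource G)"
  unfolding continuous_map_def topspace_eq gsource_preimage
proof (intro conjI allI impI)
  show "gsource G \<in> carrier G \<rightarrow> carrier G"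
    using gsource_closed by blast
next
  fix V assume "openin X V"
  then show "openin X (gset_mult G (carrier G) (V \<inter> gunits G))"
    by (metis openin_gset_mult openin_Int openin_gunits openin_topspace topspace_eq)
qed

text \<open>
  With \<open>B\<close> an open bisection around \<open>h\<close>, the sets \<open>W B\<inverse>\<close> and \<open>B\<close> work: if \<open>w k\<inverse>\<close> is composable with
  \<open>v\<close>, where \<open>k, v \<in> B\<close>, then \<open>k\<close> and \<open>v\<close> have the same range and hence agree, so \<open>w k\<inverse> v = w\<close>.
\<close>

lemma gmult_continuous:
  assumes W: "openin X W" "gmult G g h \<in> W"
    and gh: "g \<in> carrier G" "h \<in> carrier G" "gsource G g = grange G h"
  obtains U V where "openin X U" "g \<in> U" "openin X V" "h \<in> V" "gset_mult G U V \<subseteq> W"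
proof -
  have "h \<in> topspace X" using gh(2) topspace_eq by simp
  then obtain b where b: "b \<in> pfilter h"
    using Urysohn[OF openin_topspace] by blast
  note bS = point_filterD(1)[OF b] and hb = point_filterD(2)[OF b]
  let ?U = "gset_mult G W (ginv G ` dom b)"
  have Wc: "W \<subseteq> carrier G"
    using openin_subset[OF W(1)] topspace_eq by simp
  have "openin X ?U"
    using openin_gset_mult[OF W(1) openin_ginv_image[OF S_openin[OF bS]]] .
  moreover have "g \<in> ?U"
    using gset_multI[OF W(2) imageI[OF hb], of "ginv G"] gh
    by (simp add: ginv_cancel_right gsource_gmult grange_ginv)
  moreover have "gset_mult G ?U (dom b) \<subseteq> W"
  proof
    fix x assume "x \<in> gset_mult G ?U (dom b)"
    then obtain w k v where w: "w \<in> W" "k \<in> dom b" "gsource G w = grange G (ginv G k)"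
      and v: "v \<in> dom b" "gsource G (gmult G w (ginv G k)) = grange G v"
      and x: "x = gmult G (gmult G w (ginv G k)) v"
      by (auto elim!: gset_multE)
    have carr: "w \<in> carrier G" "k \<in> carrier G" "ginv G k \<in> carrier G"
      using w Wc S_carrier[OF bS] ginv_closed by auto
    have "grange G v = grange G k"
      using v(2) w(3) carr by (simp add: gsource_gmult gsource_ginv)
    then have "v = k"
      using bisection_range_eqD[OF S_bisection[OF bS] v(1) w(2)] by simp
    then have "x = w"
      using x ginv_cancel_right[OF carr(1,3) w(3)] carr by (simp add: ginv_ginv)
    then show "x \<in> W" using w by simp
  qed
  ultimately show thesis
    using that S_openin[OF bS] hb by blast
qed

text \<open>
  The compact set is the source image of \<open>[1](s b)\<close>, where \<open>a \<prec>\<^sub>s b\<close>. The set \<open>[1](s b)\<close> itself may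
  contain points that are not units, and discarding them may destroy compactness. Passing to
  sources avoids this and stays inside the source image of \<open>dom b\<close>, since the source of a
  product is the source of its right factor.
\<close>

lemma dominated_compact_between:
  assumes a: "a \<in> S" and b: "b \<in> S" and ab: "dominated G Y S D a b"
  obtains K where "compactin (subtopology X (gunits G)) K"
    "closedin (subtopology X (gunits G)) K"
    "gsource G ` dom a \<subseteq> K" "K \<subseteq> gsource G ` dom b"
proof -
  obtain s where s: "s \<in> S" "dom a \<subseteq> inverse_locus s b"
    using ab a b by (auto simp: dominated_iff)
  let ?L = "preim {\<one>} (pmult G Y s b)" and ?K = "gsource G ` preim {\<one>} (pmult G Y s b)"
  have Lc: "?L \<subseteq> carrier G"
    using S_dom_subset[OF S_pmult[OF s(1) b]] by (auto simp: preim_def)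
  have "compactin X ?K"
    using image_compactin[OF compactin_preim_one[OF S_pmult[OF s(1) b]] continuous_map_gsource] .
  then have comp: "compactin (subtopology X (gunits G)) ?K"
    using Lc by (auto simp: compactin_subtopology gsource_in_gunits)
  have "gsource G g \<in> ?K" if g: "g \<in> dom a" for g
  proof -
    have l: "g \<in> carrier G" "ginv G g \<in> dom s" "g \<in> dom b" "the (b g) \<in> Units Y"
      "the (s (ginv G g)) = inv (the (b g))"
      using g s(2) by (auto simp: inverse_locus_def)
    have "pmult G Y s b (gsource G g) = Some \<one>"
      using S_pmult_apply[OF s(1) b l(2,3) gsource_ginv[OF l(1)]] l(4,5) by (simp add: gsource_def)
    then have "gsource G g \<in> ?L"
      by (auto simp: preim_def dom_def)
    then show ?thesis
      using gsource_gsource[OF l(1)] image_eqI by metis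
  qed
  moreover have "?K \<subseteq> gsource G ` dom b"
  proof
    fix u assume "u \<in> ?K"
    then obtain k where k: "k \<in> gset_mult G (dom s) (dom b)" "u = gsource G k"
      unfolding preim_def dom_pmult by blast
    then obtain x y where xy: "x \<in> dom s" "y \<in> dom b" "gsource G x = grange G y" "k = gmult G x y"
      by (meson gset_multE)
    have "u = gsource G y"
      unfolding k(2) xy(4)
      by (rule gsource_gmult[OF S_carrier[OF s(1) xy(1)] S_carrier[OF b xy(2)] xy(3)])
    then show "u \<in> gsource G ` dom b"
      using xy(2) by blast
  qed
  ultimately show thesis
    using that[OF comp compactin_imp_closedin[OF Hausdorff_units comp]] by blast
qed

section \<open>Ultrafilters are point filters\<close>

lemma dom_filterD:
  assumes "dom_filter G Y S D F"
  shows "F \<noteq> {}" "F \<subseteq> S"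
    "\<lbrakk>a \<in> F; b \<in> F\<rbrakk> \<Longrightarrow> \<exists>d\<in>F. dominated G Y S D d a \<and> dominated G Y S D d b"
    "\<lbrakk>d \<in> F; dominated G Y S D d a; a \<in> S\<rbrakk> \<Longrightarrow> a \<in> F"
  using assms unfolding dom_filter_def by blast+

text \<open>
  The empty function is dominated by everything, so a filter containing it is all of \<open>S\<close>.
\<close>

lemma proper_iff_no_empty:
  assumes F: "dom_filter G Y S D F"
  shows "F \<noteq> S \<longleftrightarrow> Map.empty \<notin> F"
  using dom_filterD(2,4)[OF F] empty_dominated empty_in_S by blast

text \<open>
  Two members of \<open>S\<^sub>g\<close> are both invertible near \<open>g\<close>, and any Urysohn function at \<open>g\<close> whose domain is
  small enough is dominated by both.
\<close>

lemma dom_filter_point_filter: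
  assumes g: "g \<in> carrier G"
  shows "dom_filter G Y S D (pfilter g)" "pfilter g \<noteq> S"
proof -
  have "pfilter g \<noteq> {}"
    using Urysohn[OF openin_topspace, of g] g topspace_eq by auto
  moreover have "\<exists>d\<in>pfilter g. dominated G Y S D d a \<and> dominated G Y S D d b"
    if a: "a \<in> pfilter g" and b: "b \<in> pfilter g" for a b
  proof -
    obtain s V where s: "s \<in> S" "openin X V" "g \<in> V" "V \<subseteq> inverse_locus s a"
      using inverse_locus_exists[OF a] .
    obtain t W where t: "t \<in> S" "openin X W" "g \<in> W" "W \<subseteq> inverse_locus t b"
      using inverse_locus_exists[OF b] .
    obtain d where d: "d \<in> pfilter g" "dom d \<subseteq> V \<inter> W"
      using Urysohn[OF openin_Int[OF s(2) t(2)]] s(3) t(3) by blast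
    note S = point_filterD(1)[OF d(1)] point_filterD(1)[OF a] point_filterD(1)[OF b]
    have "dom d \<subseteq> inverse_locus s a" "dom d \<subseteq> inverse_locus t b"
      using s(4) t(4) d(2) by blast+
    then have "dominated G Y S D d a" "dominated G Y S D d b"
      using S s(1) t(1) dominated_iff by blast+
    then show ?thesis using d(1) by blast
  qed
  moreover have "b \<in> pfilter g"
    if "d \<in> pfilter g" "dominated G Y S D d b" "b \<in> S" for b d
    using that dominated_point_filter point_filterD(1,2) by blast
  moreover have "pfilter g \<subseteq> S"
    using point_filterD(1) by blast
  ultimately show F: "dom_filter G Y S D (pfilter g)"
    unfolding dom_filter_def by blast
  have "Map.empty \<notin> pfilter g"
    using point_filterD(2) by fastforce
  then show "pfilter g \<noteq> S"
    using proper_iff_no_empty[OF F] by simp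
qed

text \<open>
  Let \<open>F\<close> be a proper filter containing \<open>S\<^sub>g\<close>, and \<open>a \<in> F\<close>. Passing to lower bounds gives
  \<open>d \<prec> p \<prec> a\<close> in \<open>F\<close>, with \<open>dom p\<close> inside a bisection \<open>dom b\<close> containing \<open>g\<close>. If the source of \<open>g\<close> were
  outside the compact set between the source images of \<open>dom d\<close> and \<open>dom p\<close>, some member of \<open>S\<^sub>g\<close> would have a domain disjoint
  from \<open>dom d\<close>, which puts the empty function into \<open>F\<close>. So \<open>g\<close> shares its source with a point of \<open>dom p\<close>, and the
  bisection forces \<open>g \<in> dom p\<close>. The bisection is essential: without the Hausdorff property for \<open>G\<close>, the compact
  set only locates the source of \<open>g\<close>.
\<close>

lemma point_filter_maximal:
  assumes g: "g \<in> carrier G" and F: "dom_filter G Y S D F" "F \<noteq> S" and sub: "pfilter g \<subseteq> F"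
  shows "F = pfilter g"
proof (rule equalityI[OF subsetI sub])
  fix a assume a: "a \<in> F"
  note FS = dom_filterD(2)[OF F(1)]
  obtain b where b: "b \<in> pfilter g"
    using dom_filterD(1)[OF dom_filter_point_filter(1)[OF g]] by blast
  obtain p where p: "p \<in> F" "dominated G Y S D p a" "dominated G Y S D p b"
    using dom_filterD(3)[OF F(1)] a b sub by blast
  obtain d where d: "d \<in> F" "dominated G Y S D d p"
    using dom_filterD(3)[OF F(1) p(1) p(1)] by blast
  have S: "a \<in> S" "b \<in> S" "p \<in> S" "d \<in> S"
    using FS a p(1) d(1) point_filterD(1)[OF b] by auto
  obtain K where K: "closedin (subtopology X (gunits G)) K"
    "gsource G ` dom d \<subseteq> K" "K \<subseteq> gsource G ` dom p"
    using dominated_compact_between[OF S(4,3) d(2)] .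
  \<comment> \<open>Otherwise \<open>e \<in> S\<^sub>g\<close> can be chosen with sources off \<open>K\<close>, and \<open>e\<close>, \<open>d\<close> have only the empty lower bound.\<close>
  have "gsource G g \<in> K"
  proof (rule ccontr)
    assume notin: "gsource G g \<notin> K"
    have "openin (subtopology X (gunits G)) (gunits G - K)"
      using openin_diff[OF openin_topspace K(1)] openin_subset[OF openin_gunits]
      by (simp add: topspace_subtopology inf_absorb2)
    then have "openin X (gunits G - K)"
      using openin_gunits openin_trans_full by blast
    then have "openin X {h \<in> topspace X. gsource G h \<in> gunits G - K}"
      using continuous_map_gsource openin_continuous_map_preimage by blast
    moreover have "g \<in> {h \<in> topspace X. gsource G h \<in> gunits G - K}"
      using g notin topspace_eq gsource_in_gunits by simp
    ultimately obtain e where e: "e \<in> pfilter g"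
      "dom e \<subseteq> {h \<in> topspace X. gsource G h \<in> gunits G - K}"
      by (rule Urysohn)
    obtain f where f: "f \<in> F" "dominated G Y S D f e" "dominated G Y S D f d"
      using dom_filterD(3)[OF F(1), of e d] e(1) sub d(1) by blast
    have "dom f \<subseteq> dom e" "dom f \<subseteq> dom d"
      using dominated_dom_subset f FS S point_filterD(1)[OF e(1)] by blast+
    then have "dom f = {}"
      using e(2) K(2) by blast
    then have "f = Map.empty" by simp
    then show False
      using f(1) F proper_iff_no_empty by blast
  qed
  then obtain y where y: "y \<in> dom p" "gsource G y = gsource G g"
    using K(3) by (metis imageE subsetD)
  have "y \<in> dom b"
    using y(1) dominated_dom_subset[OF S(3,2) p(3)] by blast
  then have "y = g"
    using bisection_source_eqD[OF S_bisection[OF S(2)]] y(2) point_filterD(2)[OF b] by blast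
  then show "a \<in> pfilter g"
    using dominated_point_filter[OF S(3,1) p(2)] y(1) by simp
qed

lemma point_filter_ultrafilter:
  "g \<in> carrier G \<Longrightarrow> pfilter g \<in> dom_ultrafilters G Y S D"
  using dom_filter_point_filter point_filter_maximal by (auto simp: dom_ultrafilters_def)

text \<open>
  For \<open>b \<in> F\<close>, the source image of \<open>dom b\<close> contains a compact set, closed in the unit space, that
  contains the source image of \<open>dom a\<close> for some \<open>a \<in> F\<close>.
  Finitely many of these closed sets meet, because \<open>F\<close> is directed and omits the empty function; by
  compactness they all share a unit \<open>x\<close>. Restricting to members of \<open>F\<close> below a fixed \<open>b0\<close>, whose domain
  contains just one \<open>g\<close> with source \<open>x\<close>, places \<open>g\<close> in the domain of each member of \<open>F\<close>.
\<close>

lemma ultrafilter_fixed: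
  assumes F: "dom_filter G Y S D F" "F \<noteq> S"
  obtains g where "g \<in> carrier G" "F \<subseteq> pfilter g"
proof -
  let ?Z = "subtopology X (gunits G)"
  let ?C = "{K. closedin ?Z K \<and> (\<exists>a\<in>F. gsource G ` dom a \<subseteq> K)}"
  note FS = dom_filterD(2)[OF F(1)]
  have between: "\<exists>a\<in>F. \<exists>K. compactin ?Z K \<and> closedin ?Z K \<and> gsource G ` dom a \<subseteq> K \<and> K \<subseteq> gsource G ` dom b"
    if b: "b \<in> F" for b
  proof -
    obtain a where a: "a \<in> F" "dominated G Y S D a b"
      using dom_filterD(3)[OF F(1) b b] by blast
    then show ?thesis
      using dominated_compact_between[of a b] FS b by (metis subsetD)
  qed
  obtain b0 where b0: "b0 \<in> F"
    using dom_filterD(1)[OF F(1)] by blast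
  obtain a0 K0 where K0: "a0 \<in> F" "compactin ?Z K0" "closedin ?Z K0" "gsource G ` dom a0 \<subseteq> K0"
    using between[OF b0] by blast
  have finite_meet: "\<exists>d\<in>F. gsource G ` dom d \<subseteq> K0 \<inter> \<Inter>\<F>" if "finite \<F>" "\<F> \<subseteq> ?C" for \<F>
    using that
  proof (induction \<F> rule: finite_induct)
    case empty
    then show ?case using K0 by auto
  next
    case (insert K \<F>)
    then obtain d where d: "d \<in> F" "gsource G ` dom d \<subseteq> K0 \<inter> \<Inter>\<F>"
      by (meson insert_subset)
    obtain a where a: "a \<in> F" "gsource G ` dom a \<subseteq> K"
      using insert.prems by blast
    obtain e where e: "e \<in> F" "dominated G Y S D e d" "dominated G Y S D e a"
      using dom_filterD(3)[OF F(1) d(1) a(1)] by blast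
    have "dom e \<subseteq> dom d" "dom e \<subseteq> dom a"
      using dominated_dom_subset e d(1) a(1) FS by blast+
    then have "gsource G ` dom e \<subseteq> gsource G ` dom d" "gsource G ` dom e \<subseteq> gsource G ` dom a"
      by (simp_all add: image_mono)
    then have "gsource G ` dom e \<subseteq> K0 \<inter> \<Inter>(insert K \<F>)"
      using d(2) a(2) by blast
    then show ?case
      using e(1) by blast
  qed
  have nonempty: "dom d \<noteq> {}" if "d \<in> F" for d
    using that F proper_iff_no_empty[OF F(1)] by auto
  have "K0 \<inter> \<Inter>?C \<noteq> {}"
  proof (rule K0(2)[unfolded compactin_fip, THEN conjunct2, THEN spec, THEN mp],
      intro conjI ballI allI impI)
    fix \<F> assume "finite \<F> \<and> \<F> \<subseteq> ?C"
    then obtain d where "d \<in> F" "gsource G ` dom d \<subseteq> K0 \<inter> \<Inter>\<F>"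
      using finite_meet by meson
    then show "K0 \<inter> \<Inter>\<F> \<noteq> {}"
      using nonempty by blast
  qed simp
  then obtain x where x: "x \<in> \<Inter>?C" by blast
  have x_source: "x \<in> gsource G ` dom b" if "b \<in> F" for b
    using between[OF that] x by blast
  obtain g where g: "g \<in> dom b0" "x = gsource G g"
    using x_source[OF b0] by blast
  have "a \<in> pfilter g" if a: "a \<in> F" for a
  proof -
    obtain d where d: "d \<in> F" "dominated G Y S D d a" "dominated G Y S D d b0"
      using dom_filterD(3)[OF F(1) a b0] by blast
    have S: "d \<in> S" "a \<in> S" "b0 \<in> S"
      using FS a b0 d(1) by auto
    obtain y where y: "y \<in> dom d" "gsource G y = gsource G g"
      using x_source[OF d(1)] unfolding g(2) by (metis imageE)
    have "y = g"
      using bisection_source_eqD[OF S_bisection[OF S(3)] _ g(1) y(2)] y(1)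
        dominated_dom_subset[OF S(1,3) d(3)] by blast
    then show ?thesis
      using dominated_point_filter[OF S(1,2) d(2)] y(1) by simp
  qed
  moreover have "g \<in> carrier G"
    using S_carrier g(1) b0 FS by blast
  ultimately show thesis
    using that by blast
qed

lemma ultrafilter_is_point_filter:
  assumes "U \<in> dom_ultrafilters G Y S D"
  obtains g where "g \<in> carrier G" "U = pfilter g"
proof -
  have U: "dom_filter G Y S D U" "U \<noteq> S"
    and max: "\<And>F. dom_filter G Y S D F \<Longrightarrow> F \<noteq> S \<Longrightarrow> U \<subseteq> F \<Longrightarrow> F = U"
    using assms by (auto simp: dom_ultrafilters_def)
  obtain g where "g \<in> carrier G" "U \<subseteq> pfilter g"
    using ultrafilter_fixed[OF U] .
  then show thesis
    using that max dom_filter_point_filter by metis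
qed

text \<open>
  Elements with different sources are separated in the Hausdorff unit space, while distinct elements with
  the same source cannot both lie in one bisection.
\<close>

lemma point_filter_inj: "inj_on (point_filter X Y S) (carrier G)"
proof (rule inj_onI, rule ccontr)
  fix g h assume gh: "g \<in> carrier G" "h \<in> carrier G" "pfilter g = pfilter h" "g \<noteq> h"
  let ?Z = "subtopology X (gunits G)"
  obtain a where a: "a \<in> pfilter g"
    using dom_filterD(1)[OF dom_filter_point_filter(1)[OF gh(1)]] by blast
  have "gsource G g \<noteq> gsource G h"
    using bisection_source_eqD[OF S_bisection] point_filterD(1,2) a gh by metis
  moreover have "gsource G g \<in> topspace ?Z" "gsource G h \<in> topspace ?Z"
    using gh gsource_in_gunits gsource_closed by (auto simp: topspace_eq)
  ultimately obtain V W where V: "openin ?Z V" "gsource G g \<in> V" "gsource G h \<notin> V"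
    using Hausdorff_units unfolding Hausdorff_space_def disjnt_iff by metis
  have "openin X V"
    using V(1) openin_gunits openin_trans_full by blast
  then have "openin X {k \<in> topspace X. gsource G k \<in> V}"
    using continuous_map_gsource openin_continuous_map_preimage by blast
  then obtain e where "e \<in> pfilter g" "dom e \<subseteq> {k \<in> topspace X. gsource G k \<in> V}"
    using Urysohn[of _ g] gh(1) V(2) topspace_eq by (metis (no_types, lifting) mem_Collect_eq)
  then show False
    using point_filterD(2)[of e h] gh(3) V(3) by auto
qed

section \<open>The homeomorphism\<close>

text \<open>
  The preimage of the basic open set \<open>U\<^sub>a\<close> is the interior of \<open>[Y\<^sup>\<times>]a\<close>. Conversely, a Urysohn
  function \<open>a\<close> supported in an open set \<open>V\<close> has \<open>U\<^sub>a\<close> inside the image of \<open>V\<close>.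
\<close>

lemma homeomorphic_map_point_filter:
  "homeomorphic_map X (ultrafilter_topology G Y S D) (point_filter X Y S)"
proof (rule bijective_open_imp_homeomorphic_map)
  let ?T = "ultrafilter_topology G Y S D" and ?f = "point_filter X Y S"
  show "continuous_map X ?T ?f"
    unfolding ultrafilter_topology_def
  proof (rule continuous_on_generated_topo)
    fix B assume "B \<in> {{U \<in> dom_ultrafilters G Y S D. a \<in> U} | a. a \<in> S}"
    then obtain a where a: "a \<in> S" "B = {U \<in> dom_ultrafilters G Y S D. a \<in> U}"
      by blast
    have "?f -` B \<inter> topspace X = X interior_of preim (Units Y) a"
      using a point_filter_ultrafilter interior_of_subset_topspace[of X]
      by (auto simp: topspace_eq point_filter_def)
    then show "openin X (?f -` B \<inter> topspace X)" by simp
  next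
    show "?f ` topspace X \<subseteq> \<Union>{{U \<in> dom_ultrafilters G Y S D. a \<in> U} | a. a \<in> S}"
      unfolding topology_generated_by_topspace[symmetric] ultrafilter_topology_def[symmetric]
        topspace_ultrafilter_topology topspace_eq
      using point_filter_ultrafilter by blast
  qed
  show "open_map X ?T ?f"
    unfolding open_map_def
  proof (intro allI impI)
    fix V assume V: "openin X V"
    show "openin ?T (?f ` V)"
    proof (subst openin_subopen, intro ballI)
      fix U assume "U \<in> ?f ` V"
      then obtain g where g: "g \<in> V" "U = pfilter g" by blast
      obtain a where a: "a \<in> pfilter g" "dom a \<subseteq> V"
        using Urysohn[OF V g(1)] .
      let ?B = "{U \<in> dom_ultrafilters G Y S D. a \<in> U}"
      have "openin ?T ?B"
        unfolding ultrafilter_topology_def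
        using point_filterD(1)[OF a(1)] by (intro topology_generated_by_Basis) blast
      moreover have "U \<in> ?B"
        using g a(1) point_filter_ultrafilter point_filterD(4) by blast
      moreover have "?B \<subseteq> ?f ` V"
      proof
        fix U' assume "U' \<in> ?B"
        then have U': "U' \<in> dom_ultrafilters G Y S D" "a \<in> U'" by simp_all
        obtain h where "U' = pfilter h"
          using ultrafilter_is_point_filter[OF U'(1)] .
        then show "U' \<in> ?f ` V"
          using U'(2) point_filterD(2) a(2) by blast
      qed
      ultimately show "\<exists>T. openin ?T T \<and> U \<in> T \<and> T \<subseteq> ?f ` V" by blast
    qed
  qed
  show "?f ` topspace X = topspace ?T"
    unfolding topspace_ultrafilter_topology topspace_eq
    using point_filter_ultrafilter by (blast elim: ultrafilter_is_point_filter)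
  show "inj_on ?f (topspace X)"
    using point_filter_inj topspace_eq by simp
qed

section \<open>Inverses, products and grades\<close>

text \<open>
  If \<open>t \<prec>\<^sub>s r\<close> then \<open>s\<close> takes invertible values on the inverse of \<open>dom t\<close>, which is open. In the other
  direction, \<open>r\<close> comes from the Involutive axiom for \<open>s\<close> and \<open>t\<close> from Urysohn.
\<close>

lemma point_filter_ginv:
  assumes g: "g \<in> carrier G"
  shows "pfilter (ginv G g) = star_set G Y S D (pfilter g)"
proof (intro equalityI subsetI)
  fix s assume s: "s \<in> pfilter (ginv G g)"
  obtain r where r: "r \<in> S" "g \<in> X interior_of inverse_locus s r"
    using Involutive[OF s] g by (auto simp: ginv_ginv)
  obtain t where t: "t \<in> pfilter g" "dom t \<subseteq> X interior_of inverse_locus s r"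
    using Urysohn[OF openin_interior_of r(2)] .
  have "dominated_via G Y D s t r"
    using dominated_via_iff[OF point_filterD(1)[OF t(1)] point_filterD(1)[OF s] r(1)]
      t(2) interior_of_subset[of X "inverse_locus s r"] by blast
  then show "s \<in> star_set G Y S D (pfilter g)"
    using point_filterD(1)[OF s] t(1) r(1) by (auto simp: star_set_def)
next
  fix s assume "s \<in> star_set G Y S D (pfilter g)"
  then obtain t r where s: "s \<in> S" and t: "t \<in> pfilter g" and r: "r \<in> S"
    and "dominated_via G Y D s t r"
    by (auto simp: star_set_def)
  then have sub: "dom t \<subseteq> inverse_locus s r"
    using dominated_via_iff point_filterD(1) by blast
  have "ginv G ` dom t \<subseteq> preim (Units Y) s"
    using sub by (force simp: inverse_locus_def preim_def)
  then have "ginv G ` dom t \<subseteq> X interior_of preim (Units Y) s"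
    using openin_ginv_image[OF S_openin[OF point_filterD(1)[OF t]]] by (simp add: interior_of_maximal)
  then show "s \<in> pfilter (ginv G g)"
    using s point_filterD(2)[OF t] by (auto simp: point_filter_def)
qed

text \<open>
  Domination by \<open>d\<close> only depends on the domain of the dominated function. By continuity of the multiplication
  \<open>a \<in> S\<^sub>g\<close> and \<open>b \<in> S\<^sub>h\<close> can be chosen so small that \<open>dom (a b)\<close> lies where \<open>d\<close> is inverted.
\<close>

lemma point_filter_gmult:
  assumes g: "g \<in> carrier G" and h: "h \<in> carrier G" and gh: "gsource G g = grange G h"
  shows "pfilter (gmult G g h) = up_closure G Y S D (pset_mult G Y (pfilter g) (pfilter h))"
proof (intro equalityI subsetI)
  fix d assume d: "d \<in> pfilter (gmult G g h)"
  obtain s W where s: "s \<in> S" "openin X W" "gmult G g h \<in> W" "W \<subseteq> inverse_locus s d"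
    using inverse_locus_exists[OF d] .
  obtain U V where UV: "openin X U" "g \<in> U" "openin X V" "h \<in> V" "gset_mult G U V \<subseteq> W"
    using gmult_continuous[OF s(2,3) g h gh] .
  obtain a where a: "a \<in> pfilter g" "dom a \<subseteq> U"
    using Urysohn[OF UV(1,2)] .
  obtain b where b: "b \<in> pfilter h" "dom b \<subseteq> V"
    using Urysohn[OF UV(3,4)] .
  have "gset_mult G (dom a) (dom b) \<subseteq> gset_mult G U V"
    using a(2) b(2) by (fastforce simp: gset_mult_def)
  then have "dom (pmult G Y a b) \<subseteq> inverse_locus s d"
    using UV(5) s(4) by (simp add: dom_pmult)
  then have "dominated G Y S D (pmult G Y a b) d"
    using s(1) dominated_iff S_pmult point_filterD(1) a(1) b(1) d by blast
  then show "d \<in> up_closure G Y S D (pset_mult G Y (pfilter g) (pfilter h))"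
    using point_filterD(1)[OF d] a(1) b(1) by (auto simp: up_closure_def pset_mult_def)
next
  fix d assume "d \<in> up_closure G Y S D (pset_mult G Y (pfilter g) (pfilter h))"
  then obtain a b where d: "d \<in> S" and a: "a \<in> pfilter g" and b: "b \<in> pfilter h"
    and "dominated G Y S D (pmult G Y a b) d"
    by (auto simp: up_closure_def pset_mult_def)
  moreover have "gmult G g h \<in> dom (pmult G Y a b)"
    using point_filterD(2) a b gh by (simp add: dom_pmult gset_multI)
  ultimately show "d \<in> pfilter (gmult G g h)"
    using dominated_point_filter S_pmult point_filterD(1) by blast
qed

lemma pfun_grade_point_filter:
  assumes g: "g \<in> carrier G"
  shows "pfun_grade c ` pfilter g = {c g}"
proof -
  have "pfun_grade c a = c g" if a: "a \<in> pfilter g" for a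
  proof -
    have "c ` dom a = {c g}"
      using S_homogeneous[OF point_filterD(1)[OF a]] point_filterD(2)[OF a]
      unfolding homogeneous_def by blast
    then show ?thesis
      by (simp add: pfun_grade_def)
  qed
  then show ?thesis
    using dom_filterD(1)[OF dom_filter_point_filter(1)[OF g]] by force
qed

end


section \<open>Reconstruction of the groupoid\<close>

theorem theorem9p3:
  fixes X :: "'g topology" and G :: "'g groupoid" and \<Gamma> :: "'c groupoid"
    and c :: "'g \<Rightarrow> 'c" and Y :: "('y, 'm) monoid_scheme"
    and S D :: "('g \<rightharpoonup> 'y) set"
  assumes "groupoid G" and "topspace X = carrier G"
    and "Hausdorff_space (subtopology X (gunits G))"
    and "groupoid \<Gamma>" and "grading G \<Gamma> c"
    and "monoid Y" and "one_cancellative Y"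
    and "S \<subseteq> pfuns Y (hom_open_bisections X G c)"
    and "pfun_semigroup G Y S" and "bumpy X G Y S"
    and "D = diagonal G S"
  shows "homeomorphic_map X (ultrafilter_topology G Y S D) (point_filter X Y S)
    \<and> (\<forall>g\<in>carrier G. \<forall>h\<in>carrier G. gsource G g = grange G h \<longrightarrow>
          point_filter X Y S (ginv G g) = star_set G Y S D (point_filter X Y S g)
        \<and> point_filter X Y S (gmult G g h) =
            up_closure G Y S D (pset_mult G Y (point_filter X Y S g) (point_filter X Y S h))
        \<and> pfun_grade c ` point_filter X Y S g = {c g})"
proof -
  interpret bumpy_semigroup G Y X c S
    using assms by (simp add: bumpy_semigroup_def bumpy_semigroup_axioms_def)
  show ?thesis
    unfolding \<open>D = diagonal G S\<close>
    using homeomorphic_map_point_filter point_filter_ginv point_filter_gmult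
      pfun_grade_point_filter
    by blast
qed

end
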